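(* Let $\Omega\subset\mathbb R^d$ be a bounded domain with $C^{1,1}$ boundary, $u_d\in L^2(\Omega)$, $g\in L^2(\partial\Omega)$, $\beta\in(0,1)$ and $\eta>0$ with $\eta^2>\beta/(1-\beta)$, and put $C_3=\eta^2-\beta/(1-\beta)$. Let $\mathcal H$ be the Hilbert space and $C_1>0$ the constant described in the context. For $(v,h)\in\mathcal H\times L^2(\Omega)$ let $$E(v,h)=\tfrac12\|\Delta v+h\|_{L^2(\Omega)}^2+\tfrac12\|v-u_d\|_{L^2(\Omega)}^2+\tfrac12\|v-g\|_{L^2(\partial\Omega)}^2+\tfrac{\eta^2}{2}\|h\|_{L^2(\Omega)}^2,$$ and let $(u,f)\in\mathcal H\times L^2(\Omega)$ be the exact solution, i.e. the unique minimizer of $E$ over $\mathcal H\times L^2(\Omega)$. Let $\mathcal F_{\Theta_1}=\{u_{\theta_1}:\theta_1\in\Theta_1\}\subset\mathcal H$, $\mathcal F_{\Theta_2}=\{f_{\theta_2}:\theta_2\in\Theta_2\}\subset L^2(\Omega)$ and let $L:\Theta_1\times\Theta_2\to\mathbb R$ (a loss function approximating $(\theta_1,\theta_2)\mapsto E(u_{\theta_1},f_{\theta_2})$). Then there is a constant $C>0$, independent of the network parameters, such that for every $\theta^*=(\theta_1^*,\theta_2^* )\in\Theta_1\times\Theta_2$ (an inexact minimizer of $L$), with $$\mathcal E=C_1\beta\|u_{\theta_1^*}-u\|_{H^{1/2}(\Omega)}^2+(1-\beta)\|u_{\theta_1^*}-u\|_{L^2(\partial\Omega)}^2+C_3\|f_{\theta_2^*}-f\|_{L^2(\Omega)}^2,$$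 one has $$\mathcal E\le C\bigl(L(\theta^* )+\eta_{\mathrm{quad}}(\theta^* )\bigr),\qquad\eta_{\mathrm{quad}}(\theta^* )=E(u_{\theta_1^*},f_{\theta_2^*})-L(\theta_1^*,\theta_2^* ),$$ and $$\mathcal E\le C\Bigl(\delta+\inf_{(u_{\theta_1},f_{\theta_2})\in\mathcal F_{\Theta_1}\times\mathcal F_{\Theta_2}}\bigl(\|u_{\theta_1}-u\|_{\mathcal H}^2+\|f_{\theta_2}-f\|_{L^2(\Omega)}^2\bigr)\Bigr),$$ where $\delta=E(u_{\theta_1^*},f_{\theta_2^*})-\inf_{(u_{\psi_1},f_{\psi_2})\in\mathcal F_{\Theta_1}\times\mathcal F_{\Theta_2}}E(u_{\psi_1},f_{\psi_2})$.
   Context: $\mathcal H$ is the completion of $C^\infty(\overline\Omega)$ with respect to $\|u\|_{\mathcal H}=\|\Delta u\|_{L^2(\Omega)}+\|u\|_{L^2(\partial\Omega)}$; it is a Hilbert space continuously contained in $H^{1/2}(\Omega)$, and $\Delta$ and the boundary trace are extended by continuity to $\mathcal H$ (without new notation) as maps into $L^2(\Omega)$ and $L^2(\partial\Omega)$. $C_1>0$ is a constant with $C_1\|v\|_{H^{1/2}(\Omega)}^2\le\|\Delta v\|_{L^2(\Omega)}^2+\|v\|_{L^2(\partial\Omega)}^2$ for all $v\in H^2(\Omega)$ (hence for all $v\in\mathcal H$); such a constant exists. $\Theta_1,\Theta_2$ are parameter spaces of fixed neural network architectures. "Inexact minimizer" carries no optimality requirement. *)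

theory Defs
  imports "HOL-Analysis.Analysis"
begin

section \<open>Square-integrable functions\<close>

text \<open>Elements of \<open>L\<^sup>2\<close> are handled through representatives, so \<open>L2norm\<close> is a seminorm and
  \<open>L2 M\<close> is closed under changes on null sets.\<close>

definition L2 :: "'b measure \<Rightarrow> ('b \<Rightarrow> real) set" where
  "L2 M = {f \<in> borel_measurable M. integrable M (\<lambda>x. (f x)\<^sup>2)}"

definition L2norm :: "'b measure \<Rightarrow> ('b \<Rightarrow> real) \<Rightarrow> real" where
  "L2norm M f = sqrt (LINT x|M. (f x)\<^sup>2)"

text \<open>Membership in \<open>L2 M\<close> is part of convergence, since \<open>L2norm M f\<close> is meaningless when \<open>f\<close> is
  not square-integrable (a non-existing Bochner integral is \<open>0\<close>).\<close>

definition L2_conv :: "'b measure \<Rightarrow> (nat \<Rightarrow> 'b \<Rightarrow> real) \<Rightarrow> ('b \<Rightarrow> real) \<Rightarrow> bool" where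
  "L2_conv M f g \<longleftrightarrow> (\<forall>n. f n \<in> L2 M) \<and> g \<in> L2 M \<and> (\<lambda>n. L2norm M (f n - g)) \<longlonglongrightarrow> 0"

section \<open>Smooth functions\<close>

definition pd :: "'a::euclidean_space \<Rightarrow> ('a \<Rightarrow> real) \<Rightarrow> 'a \<Rightarrow> real" where
  "pd i f x = frechet_derivative f (at x) i"

definition laplace :: "('a::euclidean_space \<Rightarrow> real) \<Rightarrow> 'a \<Rightarrow> real" where
  "laplace f x = (\<Sum>i\<in>Basis. pd i (pd i f) x)"

primrec C_k :: "nat \<Rightarrow> ('a::euclidean_space \<Rightarrow> real) set" where
  "C_k 0 = {f. continuous_on UNIV f}"
| "C_k (Suc k) = {f. (\<forall>x. f differentiable (at x)) \<and> (\<forall>i\<in>Basis. pd i f \<in> C_k k)}"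

text \<open>A function that is smooth up to the boundary of a domain is the restriction of a function that
  is smooth on the whole space; it is represented by such an extension. All quantities below depend
  only on its values on the closure of the domain.\<close>

definition smooth :: "('a::euclidean_space \<Rightarrow> real) set" where
  "smooth = (\<Inter>k. C_k k)"

definition test_fun :: "'a::euclidean_space set \<Rightarrow> ('a \<Rightarrow> real) set" where
  "test_fun \<Omega> = {\<psi> \<in> smooth. compact (closure {x. \<psi> x \<noteq> 0}) \<and> closure {x. \<psi> x \<noteq> 0} \<subseteq> \<Omega>}"

section \<open>Domains with \<open>C\<^sup>1\<^sup>,\<^sup>1\<close> boundary\<close>

text \<open>Near each boundary point the domain lies above the graph of a \<open>C\<^sup>1\<^sup>,\<^sup>1\<close> function over the
  hyperplane orthogonal to a unit vector \<open>e\<close>. Such a function is encoded as a function \<open>\<gamma>\<close> on the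
  whole space that is constant in direction \<open>e\<close>.\<close>

definition C11_boundary :: "'a::euclidean_space set \<Rightarrow> bool" where
  "C11_boundary \<Omega> \<longleftrightarrow>
    (\<forall>p\<in>frontier \<Omega>. \<exists>r>0. \<exists>e. \<exists>\<gamma> :: 'a \<Rightarrow> real. \<exists>G :: 'a \<Rightarrow> 'a. \<exists>K.
       norm e = 1 \<and>
       (\<forall>x s. \<gamma> (x + s *\<^sub>R e) = \<gamma> x) \<and>
       (\<forall>x. (\<gamma> has_derivative (\<lambda>h. G x \<bullet> h)) (at x)) \<and> K-lipschitz_on UNIV G \<and>
       \<Omega> \<inter> ball p r = {x \<in> ball p r. x \<bullet> e > \<gamma> x})"

definition bounded_C11_domain :: "'a::euclidean_space set \<Rightarrow> bool" where
  "bounded_C11_domain \<Omega> \<longleftrightarrow>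
     open \<Omega> \<and> connected \<Omega> \<and> \<Omega> \<noteq> {} \<and> bounded \<Omega> \<and> C11_boundary \<Omega>"

section \<open>Surface measure\<close>

text \<open>The \<open>k\<close>-dimensional Hausdorff outer measure, normalised so that it agrees with Lebesgue
  measure in dimension \<open>k\<close>. The empty set is singled out because \<open>0 ^ 0 = 1\<close>.\<close>

definition hausdorff_outer :: "nat \<Rightarrow> 'a::euclidean_space set \<Rightarrow> ennreal" where
  "hausdorff_outer k A =
    (SUP \<delta>\<in>{0<..}. INF U\<in>{U :: nat \<Rightarrow> 'a set.
         A \<subseteq> (\<Union>n. U n) \<and> (\<forall>n. bounded (U n) \<and> diameter (U n) \<le> \<delta>)}.
       (\<Sum>n. if U n = {} then 0
            else ennreal (unit_ball_vol (real k) * (diameter (U n) / 2) ^ k)))"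

definition hausdorff_measure :: "nat \<Rightarrow> 'a::euclidean_space measure" where
  "hausdorff_measure k = measure_of UNIV (sets borel) (hausdorff_outer k)"

definition surface_measure :: "'a::euclidean_space set \<Rightarrow> 'a measure" where
  "surface_measure \<Omega> = completion (restrict_space (hausdorff_measure (DIM('a) - 1)) (frontier \<Omega>))"

abbreviation L2_dom :: "'a::euclidean_space set \<Rightarrow> ('a \<Rightarrow> real) set" where
  "L2_dom \<Omega> \<equiv> L2 (lebesgue_on \<Omega>)"

abbreviation norm_dom :: "'a::euclidean_space set \<Rightarrow> ('a \<Rightarrow> real) \<Rightarrow> real" where
  "norm_dom \<Omega> \<equiv> L2norm (lebesgue_on \<Omega>)"

abbreviation L2_bdry :: "'a::euclidean_space set \<Rightarrow> ('a \<Rightarrow> real) set" where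
  "L2_bdry \<Omega> \<equiv> L2 (surface_measure \<Omega>)"

abbreviation norm_bdry :: "'a::euclidean_space set \<Rightarrow> ('a \<Rightarrow> real) \<Rightarrow> real" where
  "norm_bdry \<Omega> \<equiv> L2norm (surface_measure \<Omega>)"

section \<open>Sobolev spaces\<close>

text \<open>\<open>H\<^sup>1\<^sup>/\<^sup>2\<close> with the Sobolev--Slobodeckij norm: the \<open>L\<^sup>2\<close> norm over \<open>\<Omega> \<times> \<Omega>\<close> of the quotient
  below has square \<open>\<integral>\<integral> \<bar>v x - v y\<bar>\<^sup>2 / \<bar>x - y\<bar>\<^bsup>d+1\<^esup> dx dy\<close>.\<close>

definition slobodeckij_quot :: "('a::euclidean_space \<Rightarrow> real) \<Rightarrow> 'a \<times> 'a \<Rightarrow> real" where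
  "slobodeckij_quot v = (\<lambda>(x, y). (v x - v y) / sqrt (norm (x - y) ^ (DIM('a) + 1)))"

definition H_half :: "'a::euclidean_space set \<Rightarrow> ('a \<Rightarrow> real) set" where
  "H_half \<Omega> = {v \<in> L2_dom \<Omega>. slobodeckij_quot v \<in> L2 (lebesgue_on \<Omega> \<Otimes>\<^sub>M lebesgue_on \<Omega>)}"

definition norm_H_half :: "'a::euclidean_space set \<Rightarrow> ('a \<Rightarrow> real) \<Rightarrow> real" where
  "norm_H_half \<Omega> v =
    sqrt ((norm_dom \<Omega> v)\<^sup>2 +
          (L2norm (lebesgue_on \<Omega> \<Otimes>\<^sub>M lebesgue_on \<Omega>) (slobodeckij_quot v))\<^sup>2)"

definition H_half_conv ::
  "'a::euclidean_space set \<Rightarrow> (nat \<Rightarrow> 'a \<Rightarrow> real) \<Rightarrow> ('a \<Rightarrow> real) \<Rightarrow> bool" where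
  "H_half_conv \<Omega> f g \<longleftrightarrow>
     (\<forall>n. f n \<in> H_half \<Omega>) \<and> g \<in> H_half \<Omega> \<and> (\<lambda>n. norm_H_half \<Omega> (f n - g)) \<longlonglongrightarrow> 0"

definition weak_pd ::
  "'a::euclidean_space set \<Rightarrow> 'a \<Rightarrow> ('a \<Rightarrow> real) \<Rightarrow> ('a \<Rightarrow> real) \<Rightarrow> bool" where
  "weak_pd \<Omega> i v w \<longleftrightarrow> v \<in> L2_dom \<Omega> \<and> w \<in> L2_dom \<Omega> \<and>
     (\<forall>\<psi>\<in>test_fun \<Omega>. (LINT x|lebesgue_on \<Omega>. v x * pd i \<psi> x) = - (LINT x|lebesgue_on \<Omega>. w x * \<psi> x))"

primrec sobolev :: "'a::euclidean_space set \<Rightarrow> nat \<Rightarrow> ('a \<Rightarrow> real) set" where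
  "sobolev \<Omega> 0 = L2_dom \<Omega>"
| "sobolev \<Omega> (Suc k) = {v \<in> L2_dom \<Omega>. \<forall>i\<in>Basis. \<exists>w\<in>sobolev \<Omega> k. weak_pd \<Omega> i v w}"

definition weak_laplace ::
  "'a::euclidean_space set \<Rightarrow> ('a \<Rightarrow> real) \<Rightarrow> ('a \<Rightarrow> real) \<Rightarrow> bool" where
  "weak_laplace \<Omega> v w \<longleftrightarrow> v \<in> L2_dom \<Omega> \<and> w \<in> L2_dom \<Omega> \<and>
     (\<forall>\<psi>\<in>test_fun \<Omega>. (LINT x|lebesgue_on \<Omega>. v x * laplace \<psi> x) = (LINT x|lebesgue_on \<Omega>. w x * \<psi> x))"

text \<open>\<open>t\<close> is the boundary trace of \<open>v \<in> H\<^sup>1\<close>: the extension by continuity, from smooth functions,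
  of the restriction to the boundary. It is a relation because the values are determined only up to
  null sets.\<close>

definition is_trace ::
  "'a::euclidean_space set \<Rightarrow> ('a \<Rightarrow> real) \<Rightarrow> ('a \<Rightarrow> real) \<Rightarrow> bool" where
  "is_trace \<Omega> v t \<longleftrightarrow>
    (\<exists>\<phi> W. (\<forall>n. \<phi> n \<in> smooth) \<and>
       L2_conv (lebesgue_on \<Omega>) \<phi> v \<and>
       (\<forall>i\<in>Basis. weak_pd \<Omega> i v (W i) \<and> L2_conv (lebesgue_on \<Omega>) (\<lambda>n. pd i (\<phi> n)) (W i)) \<and>
       L2_conv (surface_measure \<Omega>) \<phi> t)"

definition apriori_constant :: "'a::euclidean_space set \<Rightarrow> real \<Rightarrow> bool" where
  "apriori_constant \<Omega> C\<^sub>1 \<longleftrightarrow> C\<^sub>1 > 0 \<and>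
    (\<forall>v\<in>sobolev \<Omega> 2. \<forall>w t. weak_laplace \<Omega> v w \<longrightarrow> is_trace \<Omega> v t \<longrightarrow>
       C\<^sub>1 * (norm_H_half \<Omega> v)\<^sup>2 \<le> (norm_dom \<Omega> w)\<^sup>2 + (norm_bdry \<Omega> t)\<^sup>2)"

section \<open>The completion of the smooth functions\<close>

text \<open>The completion of the smooth functions in the norm
  \<open>\<parallel>\<phi>\<parallel> = \<parallel>\<Delta> \<phi>\<parallel>\<^bsub>L2(\<Omega>)\<^esub> + \<parallel>\<phi>\<parallel>\<^bsub>L2(\<partial>\<Omega>)\<^esub>\<close> is realised inside \<open>H\<^sup>1\<^sup>/\<^sup>2(\<Omega>) \<times> L\<^sup>2(\<Omega>) \<times> L\<^sup>2(\<partial>\<Omega>)\<close>: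
  the element given by a Cauchy sequence \<open>\<phi>\<close> is the triple of the limits of \<open>\<phi> n\<close> (its image in
  \<open>H\<^sup>1\<^sup>/\<^sup>2\<close>), of \<open>\<Delta> (\<phi> n)\<close> and of the boundary values of \<open>\<phi> n\<close>. All three limits exist by the estimate
  in \<open>apriori_constant\<close> and completeness, and equivalent sequences give the same triple up to null
  sets. The three projections are the inclusion into \<open>H\<^sup>1\<^sup>/\<^sup>2\<close> and the extensions by continuity of the
  Laplacian and of the boundary trace. Differences of triples are taken componentwise.\<close>

type_synonym 'a helem = "('a \<Rightarrow> real) \<times> ('a \<Rightarrow> real) \<times> ('a \<Rightarrow> real)"

definition fn :: "'a helem \<Rightarrow> 'a \<Rightarrow> real" where "fn v = fst v"
definition lap :: "'a helem \<Rightarrow> 'a \<Rightarrow> real" where "lap v = fst (snd v)"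
definition tr :: "'a helem \<Rightarrow> 'a \<Rightarrow> real" where "tr v = snd (snd v)"

definition Hspace :: "'a::euclidean_space set \<Rightarrow> 'a helem set" where
  "Hspace \<Omega> = {v. \<exists>\<phi>. (\<forall>n. \<phi> n \<in> smooth) \<and>
      H_half_conv \<Omega> \<phi> (fn v) \<and>
      L2_conv (lebesgue_on \<Omega>) (\<lambda>n. laplace (\<phi> n)) (lap v) \<and>
      L2_conv (surface_measure \<Omega>) \<phi> (tr v)}"

definition norm_H :: "'a::euclidean_space set \<Rightarrow> 'a helem \<Rightarrow> real" where
  "norm_H \<Omega> v = norm_dom \<Omega> (lap v) + norm_bdry \<Omega> (tr v)"

section \<open>The optimal control problem\<close>

definition energy ::
  "'a::euclidean_space set \<Rightarrow> ('a \<Rightarrow> real) \<Rightarrow> ('a \<Rightarrow> real) \<Rightarrow> real \<Rightarrow> 'a helem \<Rightarrow> ('a \<Rightarrow> real) \<Rightarrow> real"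
where
  "energy \<Omega> u\<^sub>d g \<eta> v h =
     1/2 * (norm_dom \<Omega> (\<lambda>x. lap v x + h x))\<^sup>2 + 1/2 * (norm_dom \<Omega> (\<lambda>x. fn v x - u\<^sub>d x))\<^sup>2 +
     1/2 * (norm_bdry \<Omega> (\<lambda>x. tr v x - g x))\<^sup>2 + \<eta>\<^sup>2 / 2 * (norm_dom \<Omega> h)\<^sup>2"

text \<open>Any two minimizers agree up to null sets, as the energy is strictly convex; hence being a
  minimizer already singles out the exact solution.\<close>

definition exact_solution ::
  "'a::euclidean_space set \<Rightarrow> ('a \<Rightarrow> real) \<Rightarrow> ('a \<Rightarrow> real) \<Rightarrow> real \<Rightarrow> 'a helem \<Rightarrow> ('a \<Rightarrow> real) \<Rightarrow> bool"
where
  "exact_solution \<Omega> u\<^sub>d g \<eta> u f \<longleftrightarrow> u \<in> Hspace \<Omega> \<and> f \<in> L2_dom \<Omega> \<and>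
     (\<forall>v\<in>Hspace \<Omega>. \<forall>h\<in>L2_dom \<Omega>. energy \<Omega> u\<^sub>d g \<eta> u f \<le> energy \<Omega> u\<^sub>d g \<eta> v h)"

end

theory Submission
  imports Defs
begin

text \<open>The energy is quadratic, so \<open>E (v, h) = E (u, f) + Q (v - u, h - f)\<close> with \<open>Q\<close> its homogeneous
  quadratic part: minimality of \<open>(u, f)\<close> kills the linear term. Splitting
  \<open>\<Delta> z = (\<Delta> z + k) - k\<close> with weights \<open>\<beta>\<close> and \<open>\<beta> / (1 - \<beta>)\<close> and using the a priori estimate,
  \<open>2 * Q\<close> dominates the error; conversely \<open>Q\<close> is bounded by a multiple of the squared norm of the
  increment. The first bound gives the a posteriori estimate because \<open>E \<ge> 0\<close>, and both together give a
  Cea-type estimate. The a priori estimate, assumed on \<open>H\<^sup>2\<close> only, applies to smooth functions (whose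
  classical derivatives are weak ones by partial integration) and hence in the limit to the whole
  completion.\<close>

section \<open>Square-integrable functions\<close>

lemma L2D:
  assumes "f \<in> L2 M"
  shows "f \<in> borel_measurable M" "integrable M (\<lambda>x. (f x)\<^sup>2)"
  using assms by (auto simp: L2_def)

lemma L2_mult_integrable:
  assumes "f \<in> L2 M" "g \<in> L2 M"
  shows "integrable M (\<lambda>x. f x * g x)"
proof (rule Bochner_Integration.integrable_bound)
  show "integrable M (\<lambda>x. (f x)\<^sup>2 + (g x)\<^sup>2)"
    using assms by (auto simp: L2_def)
  show "(\<lambda>x. f x * g x) \<in> borel_measurable M"
    using assms by (auto simp: L2_def)
  have "\<bar>a * b\<bar> \<le> a\<^sup>2 + b\<^sup>2" for a b :: real
  proof -
    have "2 * \<bar>a * b\<bar> \<le> a\<^sup>2 + b\<^sup>2"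
      using sum_squares_bound[of "\<bar>a\<bar>" "\<bar>b\<bar>"] by (simp add: abs_mult)
    thus ?thesis by simp
  qed
  then show "AE x in M. norm (f x * g x) \<le> norm ((f x)\<^sup>2 + (g x)\<^sup>2)"
    by auto
qed

lemma L2_lincomb:
  assumes "f \<in> L2 M" "g \<in> L2 M"
  shows "(\<lambda>x. a * f x + b * g x) \<in> L2 M"
proof -
  have "(a * f x + b * g x)\<^sup>2 = a\<^sup>2 * (f x)\<^sup>2 + 2 * a * b * (f x * g x) + b\<^sup>2 * (g x)\<^sup>2" for x
    by (simp add: power2_eq_square algebra_simps)
  then show ?thesis
    using assms L2_mult_integrable[OF assms] by (auto simp: L2_def)
qed

lemma L2_add: "f \<in> L2 M \<Longrightarrow> g \<in> L2 M \<Longrightarrow> (\<lambda>x. f x + g x) \<in> L2 M"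
  using L2_lincomb[of f M g 1 1] by simp

lemma L2_diff: "f \<in> L2 M \<Longrightarrow> g \<in> L2 M \<Longrightarrow> (\<lambda>x. f x - g x) \<in> L2 M"
  using L2_lincomb[of f M g 1 "-1"] by simp

lemma L2norm_nonneg [simp]: "0 \<le> L2norm M f"
  by (simp add: L2norm_def)

lemma L2norm_power2: "(L2norm M f)\<^sup>2 = (LINT x|M. (f x)\<^sup>2)"
  by (simp add: L2norm_def)

text \<open>The polynomial in \<open>t\<close> serves three times: its sign gives Cauchy--Schwarz,
  \<open>t = 1\<close> the triangle inequality, and general \<open>t\<close> the first variation of
  the energy.\<close>

lemma L2norm_power2_add_scaled:
  assumes "f \<in> L2 M" "g \<in> L2 M"
  shows "(L2norm M (\<lambda>x. f x + t * g x))\<^sup>2 =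
    (L2norm M f)\<^sup>2 + 2 * t * (LINT x|M. f x * g x) + t\<^sup>2 * (L2norm M g)\<^sup>2"
proof -
  have "(f x + t * g x)\<^sup>2 = (f x)\<^sup>2 + 2 * t * (f x * g x) + t\<^sup>2 * (g x)\<^sup>2" for x
    by (simp add: power2_eq_square algebra_simps)
  then show ?thesis
    using L2D[OF assms(1)] L2D[OF assms(2)] L2_mult_integrable[OF assms]
    by (simp add: L2norm_power2)
qed

lemma L2norm_scale: "L2norm M (\<lambda>x. c * f x) = \<bar>c\<bar> * L2norm M f"
  by (simp add: L2norm_def power_mult_distrib real_sqrt_mult)

text \<open>A quadratic polynomial in \<open>t\<close> that is never negative. As
  \<open>L2norm\<close> is only a seminorm, vanishing norms need separate choices of
  \<open>t\<close>.\<close>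

lemma L2_Cauchy_Schwarz:
  assumes "f \<in> L2 M" "g \<in> L2 M"
  shows "(LINT x|M. f x * g x) \<le> L2norm M f * L2norm M g"
proof -
  define p where "p = (LINT x|M. f x * g x)"
  define a b where "a = L2norm M f" and "b = L2norm M g"
  have ab: "a \<ge> 0" "b \<ge> 0" by (auto simp: a_def b_def)
  have q: "0 \<le> a\<^sup>2 + 2 * t * p + t\<^sup>2 * b\<^sup>2" for t
    using L2norm_power2_add_scaled[OF assms, of t] zero_le_power2
    by (metis a_def b_def p_def)
  have "p \<le> a * b"
  proof (rule ccontr)
    assume *: "\<not> p \<le> a * b"
    then have p: "p > 0" using ab by (smt (verit) mult_nonneg_nonneg)
    show False
    proof (cases "b = 0")
      case True
      \<comment> \<open>For \<open>b = 0\<close> the polynomial is affine in \<open>t\<close>, and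
        this \<open>t\<close> gives it the value -1.\<close>
      with q[of "- (a\<^sup>2 + 1) / (2 * p)"] p show False by (simp add: field_simps)
    next
      case False
      then have b: "b > 0" using ab by simp
      \<comment> \<open>This \<open>t\<close> equalizes the two square terms; the outcome
        contradicts \<open>p > a * b\<close> unless \<open>a = 0\<close>.\<close>
      have "0 \<le> a\<^sup>2 + 2 * (- a / b) * p + (- a / b)\<^sup>2 * b\<^sup>2" by (rule q)
      also have "(- a / b)\<^sup>2 * b\<^sup>2 = a\<^sup>2" using b by (simp add: power2_eq_square)
      finally have "a * p \<le> a * (a * b)" using b by (simp add: field_simps power2_eq_square)
      moreover have "a * p > a * (a * b)" if "a > 0" using that * by simp
      ultimately have "a = 0" using ab(1) by (metis leD order_le_less)
      \<comment> \<open>With \<open>a = 0\<close> the minimizing \<open>t\<close> gives the negative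
        value \<open>- p\<^sup>2 / b\<^sup>2\<close>.\<close>
      with q[of "- p / b\<^sup>2"] b mult_pos_pos[OF p p] show False
        by (simp add: field_simps power2_eq_square)
    qed
  qed
  then show ?thesis by (simp add: p_def a_def b_def)
qed

lemma L2norm_add_le:
  assumes "f \<in> L2 M" "g \<in> L2 M"
  shows "L2norm M (\<lambda>x. f x + g x) \<le> L2norm M f + L2norm M g"
proof (rule power2_le_imp_le)
  show "(L2norm M (\<lambda>x. f x + g x))\<^sup>2 \<le> (L2norm M f + L2norm M g)\<^sup>2"
    using L2norm_power2_add_scaled[OF assms, of 1] L2_Cauchy_Schwarz[OF assms]
    by (simp add: power2_sum)
qed simp

section \<open>Convergence of square-integrable functions\<close>

lemma L2_convD:
  assumes "L2_conv M f g"
  shows "f n \<in> L2 M" "g \<in> L2 M" "(\<lambda>n. L2norm M (\<lambda>x. f n x - g x)) \<longlonglongrightarrow> 0"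
  using assms by (auto simp: L2_conv_def fun_diff_def)

lemma L2_conv_const: "f \<in> L2 M \<Longrightarrow> L2_conv M (\<lambda>n. f) f"
  by (simp add: L2_conv_def L2norm_def)

lemma L2_conv_lincomb:
  assumes f: "L2_conv M f f'" and g: "L2_conv M g g'"
  shows "L2_conv M (\<lambda>n x. a * f n x + b * g n x) (\<lambda>x. a * f' x + b * g' x)"
proof -
  note F = L2_convD[OF f] and G = L2_convD[OF g]
  have "(\<lambda>n. L2norm M (\<lambda>x. (a * f n x + b * g n x) - (a * f' x + b * g' x))) \<longlonglongrightarrow> 0"
  proof (rule tendsto_sandwich[OF _ _ tendsto_const])
    show "(\<lambda>n. \<bar>a\<bar> * L2norm M (\<lambda>x. f n x - f' x) + \<bar>b\<bar> * L2norm M (\<lambda>x. g n x - g' x)) \<longlonglongrightarrow> 0"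
      using tendsto_add[OF tendsto_mult_left[OF F(3), of "\<bar>a\<bar>"] tendsto_mult_left[OF G(3), of "\<bar>b\<bar>"]]
      by simp
    show "\<forall>\<^sub>F n in sequentially. L2norm M (\<lambda>x. (a * f n x + b * g n x) - (a * f' x + b * g' x))
        \<le> \<bar>a\<bar> * L2norm M (\<lambda>x. f n x - f' x) + \<bar>b\<bar> * L2norm M (\<lambda>x. g n x - g' x)"
    proof (rule always_eventually, rule allI)
      fix n
      let ?p = "\<lambda>x. f n x - f' x" and ?q = "\<lambda>x. g n x - g' x"
      have p: "?p \<in> L2 M" "?q \<in> L2 M" using F(1,2) G(1,2) by (auto intro!: L2_diff)
      have pq: "(\<lambda>x. a * ?p x) \<in> L2 M" "(\<lambda>x. b * ?q x) \<in> L2 M"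
        using L2_lincomb[OF p, of a 0] L2_lincomb[OF p, of 0 b] by simp_all
      have "L2norm M (\<lambda>x. a * ?p x + b * ?q x) \<le> \<bar>a\<bar> * L2norm M ?p + \<bar>b\<bar> * L2norm M ?q"
        using L2norm_add_le[OF pq] by (simp only: L2norm_scale)
      then show "L2norm M (\<lambda>x. (a * f n x + b * g n x) - (a * f' x + b * g' x))
        \<le> \<bar>a\<bar> * L2norm M ?p + \<bar>b\<bar> * L2norm M ?q"
        by (simp add: algebra_simps)
    qed
  qed simp
  then show ?thesis
    using F G by (auto simp: L2_conv_def fun_diff_def intro!: L2_lincomb)
qed

text \<open>Reverse triangle inequality. It carries inequalities between norms from an approximating
  sequence to its limit.\<close>

lemma L2_conv_norm:
  assumes "L2_conv M f g"
  shows "(\<lambda>n. L2norm M (f n)) \<longlonglongrightarrow> L2norm M g"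
proof -
  note F = L2_convD[OF assms]
  have *: "\<bar>L2norm M (f n) - L2norm M g\<bar> \<le> L2norm M (\<lambda>x. f n x - g x)" for n
  proof -
    have d: "(\<lambda>x. f n x - g x) \<in> L2 M" "(\<lambda>x. g x - f n x) \<in> L2 M" using F by (auto intro: L2_diff)
    have "L2norm M (\<lambda>x. g x - f n x) = L2norm M (\<lambda>x. f n x - g x)"
      by (simp add: L2norm_def power2_commute)
    then show ?thesis
      using L2norm_add_le[OF d(1) F(2)] L2norm_add_le[OF d(2) F(1)[of n]] by simp
  qed
  have "(\<lambda>n. L2norm M (f n) - L2norm M g) \<longlonglongrightarrow> 0"
    by (rule Lim_null_comparison[OF _ F(3)]) (simp add: *)
  then show ?thesis by (rule LIM_zero_cancel)
qed

section \<open>Smooth functions and integration by parts\<close>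

lemma C_k_continuous: "f \<in> C_k k \<Longrightarrow> continuous_on UNIV f"
  by (cases k) (auto intro!: continuous_at_imp_continuous_on differentiable_imp_continuous_within)

lemma smooth_continuous: "f \<in> smooth \<Longrightarrow> continuous_on UNIV f"
  unfolding smooth_def using C_k_continuous by blast

lemma smooth_differentiable: "f \<in> smooth \<Longrightarrow> f differentiable (at x)"
  unfolding smooth_def by (metis (no_types, lifting) C_k.simps(2) INT_D UNIV_I mem_Collect_eq)

lemma smooth_pd:
  assumes "f \<in> smooth" "i \<in> Basis" shows "pd i f \<in> smooth"
proof -
  have "pd i f \<in> C_k k" for k
    using assms by (auto simp: smooth_def dest: spec[of _ "Suc k"])
  then show ?thesis by (auto simp: smooth_def)
qed

lemma pd_eqI: "(f has_derivative D) (at x) \<Longrightarrow> pd i f x = D i"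
  unfolding pd_def by (metis frechet_derivative_at)

lemma pd_has_derivative:
  "f differentiable (at x) \<Longrightarrow> (f has_derivative (\<lambda>h. pd h f x)) (at x)"
  unfolding pd_def using frechet_derivative_works by blast

lemma pd_lincomb:
  assumes "f differentiable (at x)" "g differentiable (at x)"
  shows "pd i (\<lambda>x. a * f x + b * g x) x = a * pd i f x + b * pd i g x"
  by (rule pd_eqI)
     (intro has_derivative_add has_derivative_mult_right pd_has_derivative assms)

lemma pd_mult:
  assumes "f differentiable (at x)" "g differentiable (at x)"
  shows "pd i (\<lambda>x. f x * g x) x = f x * pd i g x + pd i f x * g x"
  by (rule pd_eqI) (intro has_derivative_mult pd_has_derivative assms)

lemma C_k_lincomb:
  "f \<in> C_k k \<Longrightarrow> g \<in> C_k k \<Longrightarrow> (\<lambda>x. a * f x + b * g x) \<in> C_k k"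
proof (induction k arbitrary: f g)
  case 0
  then show ?case by (auto intro!: continuous_intros)
next
  case (Suc k)
  have "pd i (\<lambda>x. a * f x + b * g x) = (\<lambda>x. a * pd i f x + b * pd i g x)" for i
    using Suc.prems by (intro ext pd_lincomb) auto
  then show ?case using Suc by auto
qed

lemma smooth_lincomb:
  "f \<in> smooth \<Longrightarrow> g \<in> smooth \<Longrightarrow> (\<lambda>x. a * f x + b * g x) \<in> smooth"
  by (auto simp: smooth_def intro: C_k_lincomb)

lemma laplace_lincomb:
  assumes "f \<in> smooth" "g \<in> smooth"
  shows "laplace (\<lambda>x. a * f x + b * g x) = (\<lambda>x. a * laplace f x + b * laplace g x)"
proof
  fix x
  have "pd i (pd i (\<lambda>x. a * f x + b * g x)) x = a * pd i (pd i f) x + b * pd i (pd i g) x"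
    if i: "i \<in> Basis" for i
  proof -
    have "pd i (\<lambda>x. a * f x + b * g x) = (\<lambda>x. a * pd i f x + b * pd i g x)"
      using assms by (intro ext pd_lincomb smooth_differentiable)
    then show ?thesis
      using assms i by (simp add: pd_lincomb smooth_differentiable smooth_pd)
  qed
  then show "laplace (\<lambda>x. a * f x + b * g x) x = a * laplace f x + b * laplace g x"
    by (simp add: laplace_def sum.distrib sum_distrib_left)
qed

text \<open>The complement of the support is open, so \<open>f\<close> vanishes on a whole
  neighbourhood of \<open>x\<close>.\<close>

lemma pd_eq_0_outside_support:
  assumes "x \<notin> closure {x. f x \<noteq> 0}"
  shows "pd i f x = 0"
proof -
  have "(f has_derivative (\<lambda>_. 0)) (at x)"
  proof (rule has_derivative_transform_within_open)
    show "((\<lambda>_. 0) has_derivative (\<lambda>_. 0)) (at x)" by (rule has_derivative_const)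
    show "open (- closure {x. f x \<noteq> 0})" by auto
    show "x \<in> - closure {x. f x \<noteq> 0}" using assms by simp
    show "\<And>y. y \<in> - closure {x. f x \<noteq> 0} \<Longrightarrow> 0 = f y"
      using closure_subset[of "{x. f x \<noteq> 0}"] by auto
  qed
  from pd_eqI[OF this] show ?thesis .
qed

lemma closed_subset_compact: "closed S \<Longrightarrow> S \<subseteq> T \<Longrightarrow> compact T \<Longrightarrow> compact S"
  by (metis compact_Int_closed inf.absorb_iff2)

lemma pd_test_fun:
  assumes "\<psi> \<in> test_fun \<Omega>" "i \<in> Basis" shows "pd i \<psi> \<in> test_fun \<Omega>"
proof -
  have sub: "closure {x. pd i \<psi> x \<noteq> 0} \<subseteq> closure {x. \<psi> x \<noteq> 0}"
    by (rule closure_minimal) (use pd_eq_0_outside_support in blast)+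
  then show ?thesis
    using assms smooth_pd closed_subset_compact[OF closed_closure sub]
    by (auto simp: test_fun_def)
qed

section \<open>Integrability of continuous functions and integration by parts\<close>

lemma continuous_bounded_integrable_lebesgue_on:
  fixes f :: "'a::euclidean_space \<Rightarrow> real"
  assumes "continuous_on UNIV f" "bounded \<Omega>" "\<Omega> \<in> sets lebesgue"
  shows "integrable (lebesgue_on \<Omega>) f"
proof -
  obtain a where a: "\<Omega> \<subseteq> cbox (-a) a" using bounded_subset_cbox_symmetric assms(2) by blast
  have "f absolutely_integrable_on cbox (-a) a"
    using assms(1) by (intro absolutely_integrable_continuous) (auto intro: continuous_on_subset)
  then have "f absolutely_integrable_on \<Omega>"
    using assms(3) a by (rule set_integrable_subset)
  then show ?thesis
    using assms(3) by (simp add: integrable_restrict_space set_integrable_def)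
qed

lemma continuous_L2_dom:
  fixes f :: "'a::euclidean_space \<Rightarrow> real"
  assumes "continuous_on UNIV f" "bounded \<Omega>" "\<Omega> \<in> sets lebesgue"
  shows "f \<in> L2_dom \<Omega>"
  using continuous_bounded_integrable_lebesgue_on[OF assms]
    continuous_bounded_integrable_lebesgue_on[of "\<lambda>x. (f x)\<^sup>2", OF _ assms(2,3)] assms(1)
  by (auto simp: L2_def intro!: continuous_intros)

lemma lborel_integral_translate:
  fixes g :: "'a::euclidean_space \<Rightarrow> real"
  assumes "integrable lborel g"
  shows "integrable lborel (\<lambda>x. g (x + v))" "(LINT x|lborel. g (x + v)) = (LINT x|lborel. g x)"
proof -
  have g: "g \<in> borel_measurable borel" using assms by auto
  have inv: "distr lborel borel (\<lambda>x. v + x) = (lborel :: 'a measure)"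
    by (rule lborel_distr_plus)
  have "(LINT x|distr lborel borel (\<lambda>x. v + x). g x) = (LINT x|lborel. g (v + x))"
    using g by (intro integral_distr) auto
  then show "(LINT x|lborel. g (x + v)) = (LINT x|lborel. g x)"
    unfolding inv by (simp add: add.commute)
  have "integrable (distr lborel borel (\<lambda>x. v + x)) g \<longleftrightarrow> integrable lborel (\<lambda>x. g (v + x))"
    using g by (intro integrable_distr_eq) auto
  then show "integrable lborel (\<lambda>x. g (x + v))"
    using assms unfolding inv by (simp add: add.commute)
qed

text \<open>By translation invariance the difference quotients of \<open>g\<close> have integral \<open>0\<close>, and dominated
  convergence passes this to the derivative, so no iterated integration is needed.\<close>

lemma integral_pd_eq_0:
  fixes g :: "'a::euclidean_space \<Rightarrow> real"
  assumes d: "\<And>x. g differentiable (at x)" and c: "continuous_on UNIV (pd i g)"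
    and K: "compact (closure {x. g x \<noteq> 0})" and i: "i \<in> Basis"
  shows "(LINT x|lborel. pd i g x) = 0"
proof -
  have cg: "continuous_on UNIV g"
    using d by (auto intro!: continuous_at_imp_continuous_on differentiable_imp_continuous_within)
  obtain R where R: "\<And>x. x \<in> closure {x. g x \<noteq> 0} \<Longrightarrow> norm x \<le> R"
    using compact_imp_bounded[OF K] by (auto simp: bounded_iff)
  have g0: "g x = 0" if "norm x > R" for x
    using R[of x] that closure_subset[of "{x. g x \<noteq> 0}"] by force
  have "bounded (pd i g ` closure {x. g x \<noteq> 0})"
    by (intro compact_imp_bounded compact_continuous_image continuous_on_subset[OF c] K) auto
  then obtain M where M: "M > 0" "\<And>x. x \<in> closure {x. g x \<noteq> 0} \<Longrightarrow> \<bar>pd i g x\<bar> \<le> M"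
    by (auto simp: bounded_pos)
  \<comment> \<open>The derivative vanishes off the support, so its bound on that compact set is
    global.\<close>
  have M: "M > 0" "\<bar>pd i g x\<bar> \<le> M" for x
    using M pd_eq_0_outside_support[of x g i] by (cases "x \<in> closure {x. g x \<noteq> 0}"; simp)+
  \<comment> \<open>Restriction to lines in direction \<open>i\<close> turns \<open>pd i g\<close>
    into an ordinary derivative, by the chain rule and linearity of the Frechet derivative.\<close>
  have der: "((\<lambda>t. g (x + t *\<^sub>R i)) has_real_derivative pd i g (x + t *\<^sub>R i)) (at t)" for x t
  proof -
    have "((\<lambda>t. g (x + t *\<^sub>R i)) has_derivative (\<lambda>h. pd (h *\<^sub>R i) g (x + t *\<^sub>R i))) (at t)"
      by (rule has_derivative_compose[OF _ pd_has_derivative[OF d], of "\<lambda>t. x + t *\<^sub>R i"])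
         (auto intro!: derivative_eq_intros)
    moreover have "pd (h *\<^sub>R i) g y = h * pd i g y" for h y
      unfolding pd_def using linear_frechet_derivative[OF d[of y]] by (simp add: linear_scale)
    moreover have "(\<lambda>h. h * c) = (*) c" for c :: real by (simp add: fun_eq_iff)
    ultimately show ?thesis by (simp add: has_field_derivative_def)
  qed
  \<comment> \<open>Steps of length at most 1 keep every difference quotient supported in the ball
    of radius \<open>R + 1\<close>.\<close>
  define t where "t n = 1 / real (Suc n)" for n
  have t: "0 < t n" "t n \<le> 1" for n by (auto simp: t_def)
  have t0: "t \<longlonglongrightarrow> 0"
    using LIMSEQ_Suc[OF lim_inverse_n'] by (simp add: t_def [abs_def])
  define q where "q n x = (g (x + t n *\<^sub>R i) - g x) / t n" for n x
  have lim: "(\<lambda>n. q n x) \<longlonglongrightarrow> pd i g x" for x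
  proof -
    have "((\<lambda>h. (g (x + h *\<^sub>R i) - g x) / h) \<longlongrightarrow> pd i g x) (at 0)"
      using der[of x 0] by (simp add: DERIV_def)
    moreover have "filterlim t (at 0) sequentially"
      using t0 t(1) by (simp add: filterlim_at less_imp_neq[symmetric])
    ultimately show ?thesis unfolding q_def by (rule filterlim_compose)
  qed
  \<comment> \<open>The mean value theorem bounds all quotients by the bound for the derivative;
    together with the common support this yields an integrable majorant.\<close>
  have qM: "\<bar>q n x\<bar> \<le> M" for n x
  proof -
    obtain z where "g (x + t n *\<^sub>R i) - g (x + 0 *\<^sub>R i) = (t n - 0) * pd i g (x + z *\<^sub>R i)"
      using MVT2[of 0 "t n" "\<lambda>t. g (x + t *\<^sub>R i)" "\<lambda>z. pd i g (x + z *\<^sub>R i)"] der t by blast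
    then show ?thesis using M(2) t[of n] by (simp add: q_def)
  qed
  have q0: "q n x = 0" if "x \<notin> cball 0 (R + 1)" for n x
  proof -
    have "norm x \<le> norm (x + t n *\<^sub>R i) + norm (t n *\<^sub>R i)"
      using norm_triangle_ineq4[of "x + t n *\<^sub>R i" "t n *\<^sub>R i"] by simp
    moreover have "norm (t n *\<^sub>R i) \<le> 1" using t[of n] i by simp
    ultimately show ?thesis using g0[of x] g0[of "x + t n *\<^sub>R i"] that by (simp add: q_def)
  qed
  have mg: "g \<in> borel_measurable borel" "pd i g \<in> borel_measurable borel"
    using cg c by (auto intro: borel_measurable_continuous_onI)
  have mq: "q n \<in> borel_measurable borel" for n
    unfolding q_def [abs_def] using t(1)[of n]
    by (intro borel_measurable_continuous_onI continuous_intros continuous_on_compose2[OF cg]) auto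
  have "(\<lambda>n. LINT x|lborel. q n x) \<longlonglongrightarrow> (LINT x|lborel. pd i g x)"
  proof (rule integral_dominated_convergence)
    show "integrable lborel (\<lambda>x. M * indicator (cball 0 (R + 1)) x :: real)"
      by (rule integrable_mult_right[OF integrable_real_indicator])
         (simp_all add: emeasure_lborel_cball_finite[unfolded infinity_ennreal_def])
    show "AE x in lborel. norm (q n x) \<le> M * indicator (cball 0 (R + 1)) x" for n
    proof (rule AE_I2)
      fix x
      show "norm (q n x) \<le> M * indicator (cball 0 (R + 1)) x"
        using qM[of n x] q0[of x n] by (cases "x \<in> cball 0 (R + 1)") simp_all
    qed
    show "AE x in lborel. (\<lambda>n. q n x) \<longlonglongrightarrow> pd i g x"
      by (rule AE_I2) (rule lim)
    show "pd i g \<in> borel_measurable lborel" "q n \<in> borel_measurable lborel" for n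
      using mg(2) mq by simp_all
  qed
  \<comment> \<open>Integrability of \<open>g\<close> allows the integral of the quotient to be
    split into two integrals, which translation invariance makes equal.\<close>
  moreover have "(LINT x|lborel. q n x) = 0" for n
  proof -
    have ig: "integrable lborel g"
    proof -
      have "integrable lborel (\<lambda>x. indicator (cball 0 R) x *\<^sub>R g x)"
        by (rule borel_integrable_compact) (auto intro: continuous_on_subset[OF cg])
      moreover have "(\<lambda>x. indicator (cball 0 R) x *\<^sub>R g x) = g"
        using g0 by (auto simp: indicator_def fun_eq_iff)
      ultimately show ?thesis by simp
    qed
    show ?thesis
      using ig lborel_integral_translate[OF ig, of "t n *\<^sub>R i"] by (simp add: q_def)
  qed
  ultimately have "(\<lambda>n. 0) \<longlonglongrightarrow> (LINT x|lborel. pd i g x)" by simp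
  then show ?thesis by (simp add: LIMSEQ_const_iff)
qed

lemma open_sets_lebesgue: "open \<Omega> \<Longrightarrow> \<Omega> \<in> sets lebesgue"
  by (intro sets_completionI_sets) simp

text \<open>The product \<open>\<phi> x * \<psi> x\<close> has compact support inside
  \<open>\<Omega>\<close>, so the integral of its derivative vanishes by
  \<open>integral_pd_eq_0\<close>. No boundary term arises.\<close>

lemma integration_by_parts:
  fixes \<Omega> :: "'a::euclidean_space set"
  assumes \<phi>: "\<phi> \<in> smooth" and \<psi>: "\<psi> \<in> test_fun \<Omega>" and i: "i \<in> Basis"
    and \<Omega>: "open \<Omega>" "bounded \<Omega>"
  shows "(LINT x|lebesgue_on \<Omega>. \<phi> x * pd i \<psi> x) = - (LINT x|lebesgue_on \<Omega>. pd i \<phi> x * \<psi> x)"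
proof -
  have \<Omega>_lebesgue: "\<Omega> \<in> sets lebesgue" using \<Omega>(1) by (simp add: open_sets_lebesgue)
  have \<psi>s: "\<psi> \<in> smooth" and K: "compact (closure {x. \<psi> x \<noteq> 0})" "closure {x. \<psi> x \<noteq> 0} \<subseteq> \<Omega>"
    using \<psi> by (auto simp: test_fun_def)
  let ?g = "\<lambda>x. \<phi> x * \<psi> x"
  note cont = smooth_continuous[OF \<phi>] smooth_continuous[OF \<psi>s]
    smooth_continuous[OF smooth_pd[OF \<phi> i]] smooth_continuous[OF smooth_pd[OF \<psi>s i]]
  note diff = smooth_differentiable[OF \<phi>] smooth_differentiable[OF \<psi>s]
  have pd_g: "pd i ?g = (\<lambda>x. \<phi> x * pd i \<psi> x + pd i \<phi> x * \<psi> x)"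
    using diff by (intro ext pd_mult)
  have c: "continuous_on UNIV (pd i ?g)"
    unfolding pd_g by (intro continuous_intros cont)
  have sub: "closure {x. ?g x \<noteq> 0} \<subseteq> closure {x. \<psi> x \<noteq> 0}"
    by (intro closure_mono) auto
  \<comment> \<open>This allows the integral over \<open>\<Omega>\<close> to be replaced by one over
    the whole space.\<close>
  have 0: "pd i ?g x = 0" if "x \<notin> \<Omega>" for x
    using pd_eq_0_outside_support[of x ?g i] that sub K(2) by blast
  have int: "integrable (lebesgue_on \<Omega>) (\<lambda>x. \<phi> x * pd i \<psi> x)"
    "integrable (lebesgue_on \<Omega>) (\<lambda>x. pd i \<phi> x * \<psi> x)"
    by (intro continuous_bounded_integrable_lebesgue_on[OF _ \<Omega>(2) \<Omega>_lebesgue] continuous_intros cont)+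
  have "(LINT x|lebesgue_on \<Omega>. \<phi> x * pd i \<psi> x) + (LINT x|lebesgue_on \<Omega>. pd i \<phi> x * \<psi> x)
      = (LINT x|lebesgue_on \<Omega>. pd i ?g x)"
    using int by (simp add: pd_g)
  also have "\<dots> = (LINT x|lebesgue. indicator \<Omega> x *\<^sub>R pd i ?g x)"
    using \<Omega>_lebesgue by (subst integral_restrict_space) auto
  also have "(\<lambda>x. indicator \<Omega> x *\<^sub>R pd i ?g x) = pd i ?g"
    using 0 by (auto simp: indicator_def fun_eq_iff)
  also have "(LINT x|lebesgue. pd i ?g x) = (LINT x|lborel. pd i ?g x)"
    using borel_measurable_continuous_onI[OF c] by (intro integral_completion) simp
  also have "\<dots> = 0"
    using diff closed_subset_compact[OF closed_closure sub K(1)] i c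
    by (intro integral_pd_eq_0) auto
  finally show ?thesis by simp
qed

section \<open>Classical derivatives and boundary values as weak ones\<close>

lemma smooth_weak_pd:
  assumes "\<phi> \<in> smooth" "i \<in> Basis" "open \<Omega>" "bounded \<Omega>"
  shows "weak_pd \<Omega> i \<phi> (pd i \<phi>)"
  using assms integration_by_parts[OF assms(1) _ assms(2-4)]
  by (auto simp: weak_pd_def open_sets_lebesgue intro!: continuous_L2_dom smooth_continuous smooth_pd)

text \<open>Induction works because the weak derivatives can be taken to be the classical ones,
  which are smooth again.\<close>

lemma smooth_sobolev:
  assumes "open \<Omega>" "bounded \<Omega>"
  shows "\<phi> \<in> smooth \<Longrightarrow> \<phi> \<in> sobolev \<Omega> k"
proof (induction k arbitrary: \<phi>)
  case 0
  then show ?case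
    using assms by (auto intro!: continuous_L2_dom smooth_continuous simp: open_sets_lebesgue)
next
  case (Suc k)
  have "\<phi> \<in> L2_dom \<Omega>"
    using assms Suc.prems by (auto intro!: continuous_L2_dom smooth_continuous simp: open_sets_lebesgue)
  moreover have "\<forall>i\<in>Basis. \<exists>w\<in>sobolev \<Omega> k. weak_pd \<Omega> i \<phi> w"
    using smooth_weak_pd[OF Suc.prems _ assms] Suc.IH smooth_pd[OF Suc.prems] by blast
  ultimately show ?case by simp
qed

lemma smooth_weak_laplace:
  fixes \<Omega> :: "'a::euclidean_space set"
  assumes \<phi>: "\<phi> \<in> smooth" and \<Omega>: "open \<Omega>" "bounded \<Omega>"
  shows "weak_laplace \<Omega> \<phi> (laplace \<phi>)"
proof -
  have \<Omega>_lebesgue: "\<Omega> \<in> sets lebesgue" using \<Omega>(1) by (simp add: open_sets_lebesgue)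
  have c: "continuous_on UNIV (pd i (pd i \<xi>))" if "i \<in> Basis" "\<xi> \<in> smooth" for i and \<xi> :: "'a \<Rightarrow> real"
    using that by (intro smooth_continuous smooth_pd)
  have cl: "continuous_on UNIV (laplace \<phi>)"
    unfolding laplace_def [abs_def] by (intro continuous_on_sum c \<phi>)
  have "(LINT x|lebesgue_on \<Omega>. \<phi> x * laplace \<psi> x) = (LINT x|lebesgue_on \<Omega>. laplace \<phi> x * \<psi> x)"
    if \<psi>: "\<psi> \<in> test_fun \<Omega>" for \<psi>
  proof -
    have \<psi>s: "\<psi> \<in> smooth" using \<psi> by (simp add: test_fun_def)
    have "(LINT x|lebesgue_on \<Omega>. \<phi> x * laplace \<psi> x)
        = (\<Sum>i\<in>Basis. LINT x|lebesgue_on \<Omega>. \<phi> x * pd i (pd i \<psi>) x)"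
      unfolding laplace_def sum_distrib_left
      by (intro Bochner_Integration.integral_sum continuous_bounded_integrable_lebesgue_on
            continuous_intros smooth_continuous[OF \<phi>] c \<psi>s \<Omega> \<Omega>_lebesgue)
    \<comment> \<open>Two integrations by parts, first against the test function
      \<open>pd i \<psi>\<close>, then with the smooth function \<open>pd i \<phi>\<close>; the two
      signs cancel.\<close>
    also have "\<dots> = (\<Sum>i\<in>Basis. LINT x|lebesgue_on \<Omega>. pd i (pd i \<phi>) x * \<psi> x)"
      using integration_by_parts[OF \<phi> pd_test_fun[OF \<psi>] _ \<Omega>]
        integration_by_parts[OF smooth_pd[OF \<phi>] \<psi> _ \<Omega>] by (intro sum.cong) auto
    also have "\<dots> = (LINT x|lebesgue_on \<Omega>. laplace \<phi> x * \<psi> x)"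
      unfolding laplace_def sum_distrib_right
      by (intro Bochner_Integration.integral_sum[symmetric] continuous_bounded_integrable_lebesgue_on
            continuous_intros smooth_continuous[OF \<psi>s] c \<phi> \<Omega> \<Omega>_lebesgue)
    finally show ?thesis .
  qed
  then show ?thesis
    using continuous_L2_dom[OF smooth_continuous[OF \<phi>] \<Omega>(2) \<Omega>_lebesgue]
      continuous_L2_dom[OF cl \<Omega>(2) \<Omega>_lebesgue]
    by (auto simp: weak_laplace_def)
qed

text \<open>The constant sequence is a valid approximation. Square integrability on the boundary is
  later supplied by the convergence in \<open>Hspace\<close>.\<close>

lemma smooth_is_trace:
  assumes \<phi>: "\<phi> \<in> smooth" "\<phi> \<in> L2_bdry \<Omega>" and \<Omega>: "open \<Omega>" "bounded \<Omega>"
  shows "is_trace \<Omega> \<phi> \<phi>"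
  unfolding is_trace_def
proof (rule exI[of _ "\<lambda>n. \<phi>"], rule exI[of _ "\<lambda>i. pd i \<phi>"], intro conjI ballI allI)
  fix i :: 'a assume "i \<in> Basis"
  then show *: "weak_pd \<Omega> i \<phi> (pd i \<phi>)" by (intro smooth_weak_pd \<phi> \<Omega>)
  then show "L2_conv (lebesgue_on \<Omega>) (\<lambda>n. pd i \<phi>) (pd i \<phi>)"
    by (intro L2_conv_const) (simp add: weak_pd_def)
next
  show "L2_conv (lebesgue_on \<Omega>) (\<lambda>n. \<phi>) \<phi>"
    using smooth_weak_laplace[OF \<phi>(1) \<Omega>] by (intro L2_conv_const) (simp add: weak_laplace_def)
qed (use \<phi> in \<open>auto intro: L2_conv_const\<close>)

section \<open>The completion\<close>

lemma slobodeckij_quot_lincomb: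
  "slobodeckij_quot (\<lambda>x. a * v x + b * w x) =
    (\<lambda>z. a * slobodeckij_quot v z + b * slobodeckij_quot w z)"
  by (auto simp: slobodeckij_quot_def fun_eq_iff diff_divide_distrib add_divide_distrib algebra_simps)

lemma norm_H_half_power2:
  "(norm_H_half \<Omega> v)\<^sup>2 = (norm_dom \<Omega> v)\<^sup>2 +
     (L2norm (lebesgue_on \<Omega> \<Otimes>\<^sub>M lebesgue_on \<Omega>) (slobodeckij_quot v))\<^sup>2"
  by (simp add: norm_H_half_def)

text \<open>The norm is the Euclidean combination of two \<open>L2norm\<close> terms and
  \<open>slobodeckij_quot\<close> is linear. Facts about \<open>L2_conv\<close> thereby carry over
  to the fractional space.\<close>

lemma H_half_conv_iff_L2_conv:
  "H_half_conv \<Omega> f g \<longleftrightarrow> L2_conv (lebesgue_on \<Omega>) f g \<and>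
     L2_conv (lebesgue_on \<Omega> \<Otimes>\<^sub>M lebesgue_on \<Omega>) (\<lambda>n. slobodeckij_quot (f n)) (slobodeckij_quot g)"
proof -
  let ?M = "lebesgue_on \<Omega>" and ?P = "lebesgue_on \<Omega> \<Otimes>\<^sub>M lebesgue_on \<Omega>"
  have d: "slobodeckij_quot (v - w) = slobodeckij_quot v - slobodeckij_quot w" for v w :: "'a \<Rightarrow> real"
    using slobodeckij_quot_lincomb[of 1 v "-1" w] by (simp add: fun_diff_def)
  define p q where "p n = L2norm ?M (f n - g)"
    and "q n = L2norm ?P (slobodeckij_quot (f n) - slobodeckij_quot g)" for n
  have n: "norm_H_half \<Omega> (f n - g) = sqrt ((p n)\<^sup>2 + (q n)\<^sup>2)" for n
    by (simp add: norm_H_half_def d p_def q_def)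
  have "(\<lambda>n. sqrt ((p n)\<^sup>2 + (q n)\<^sup>2)) \<longlonglongrightarrow> 0 \<longleftrightarrow> p \<longlonglongrightarrow> 0 \<and> q \<longlonglongrightarrow> 0"
  proof (intro iffI conjI)
    assume *: "(\<lambda>n. sqrt ((p n)\<^sup>2 + (q n)\<^sup>2)) \<longlonglongrightarrow> 0"
    show "p \<longlonglongrightarrow> 0"
      \<comment> \<open>Each component is dominated by the square root of the sum of
        squares.\<close>
      by (rule Lim_null_comparison[OF _ *]) (auto simp: p_def intro!: always_eventually real_le_rsqrt)
    show "q \<longlonglongrightarrow> 0"
      by (rule Lim_null_comparison[OF _ *]) (auto simp: q_def intro!: always_eventually real_le_rsqrt)
  next
    assume *: "p \<longlonglongrightarrow> 0 \<and> q \<longlonglongrightarrow> 0"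
    have "(\<lambda>n. sqrt ((p n)\<^sup>2 + (q n)\<^sup>2)) \<longlonglongrightarrow> sqrt (0\<^sup>2 + 0\<^sup>2)"
      using * by (intro tendsto_intros) auto
    then show "(\<lambda>n. sqrt ((p n)\<^sup>2 + (q n)\<^sup>2)) \<longlonglongrightarrow> 0" by simp
  qed
  then show ?thesis
    unfolding H_half_conv_def L2_conv_def H_half_def n p_def q_def by auto
qed

lemma norm_H_half_conv:
  assumes "H_half_conv \<Omega> f g"
  shows "(\<lambda>n. norm_H_half \<Omega> (f n)) \<longlonglongrightarrow> norm_H_half \<Omega> g"
  using assms unfolding H_half_conv_iff_L2_conv norm_H_half_def
  by (intro tendsto_intros) (auto dest: L2_conv_norm)

section \<open>Linear structure of the completion and the extended a priori estimate\<close>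

lemma HspaceD:
  assumes "v \<in> Hspace \<Omega>"
  shows "fn v \<in> L2_dom \<Omega>" "lap v \<in> L2_dom \<Omega>" "tr v \<in> L2_bdry \<Omega>"
  using assms by (auto simp: Hspace_def H_half_conv_iff_L2_conv L2_conv_def)

lemma helem_diff_simps:
  fixes v w :: "'a::euclidean_space helem"
  shows "fn (v - w) = (\<lambda>x. fn v x - fn w x)" "lap (v - w) = (\<lambda>x. lap v x - lap w x)"
    "tr (v - w) = (\<lambda>x. tr v x - tr w x)"
  by (simp_all add: fn_def lap_def tr_def fun_diff_def)

text \<open>The same combination of the two approximating sequences works for all three components
  at once. It is needed for errors \<open>v - u\<close> and for variations of the minimizer.\<close>

lemma Hspace_lincomb:
  assumes v: "v \<in> Hspace \<Omega>" and w: "w \<in> Hspace \<Omega>"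
  shows "(\<lambda>x. a * fn v x + b * fn w x, \<lambda>x. a * lap v x + b * lap w x,
    \<lambda>x. a * tr v x + b * tr w x) \<in> Hspace \<Omega>"
proof -
  obtain \<phi> where \<phi>: "\<And>n. \<phi> n \<in> smooth" "H_half_conv \<Omega> \<phi> (fn v)"
      "L2_conv (lebesgue_on \<Omega>) (\<lambda>n. laplace (\<phi> n)) (lap v)" "L2_conv (surface_measure \<Omega>) \<phi> (tr v)"
    using v by (auto simp: Hspace_def)
  obtain \<omega> where \<omega>: "\<And>n. \<omega> n \<in> smooth" "H_half_conv \<Omega> \<omega> (fn w)"
      "L2_conv (lebesgue_on \<Omega>) (\<lambda>n. laplace (\<omega> n)) (lap w)" "L2_conv (surface_measure \<Omega>) \<omega> (tr w)"
    using w by (auto simp: Hspace_def)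
  let ?\<xi> = "\<lambda>n x. a * \<phi> n x + b * \<omega> n x"
  have "H_half_conv \<Omega> ?\<xi> (\<lambda>x. a * fn v x + b * fn w x)"
    using \<phi>(2) \<omega>(2) unfolding H_half_conv_iff_L2_conv slobodeckij_quot_lincomb
    by (auto intro: L2_conv_lincomb)
  moreover have "L2_conv (lebesgue_on \<Omega>) (\<lambda>n. laplace (?\<xi> n)) (\<lambda>x. a * lap v x + b * lap w x)"
    unfolding laplace_lincomb[OF \<phi>(1) \<omega>(1)] by (rule L2_conv_lincomb[OF \<phi>(3) \<omega>(3)])
  moreover have "L2_conv (surface_measure \<Omega>) ?\<xi> (\<lambda>x. a * tr v x + b * tr w x)"
    by (rule L2_conv_lincomb[OF \<phi>(4) \<omega>(4)])
  moreover have "?\<xi> n \<in> smooth" for n by (rule smooth_lincomb[OF \<phi>(1) \<omega>(1)])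
  ultimately show ?thesis
    unfolding Hspace_def by (auto simp: fn_def lap_def tr_def intro!: exI[of _ ?\<xi>])
qed

lemma Hspace_diff:
  assumes "v \<in> Hspace \<Omega>" "w \<in> Hspace \<Omega>" shows "v - w \<in> Hspace \<Omega>"
proof -
  have "v - w = (\<lambda>x. 1 * fn v x + (- 1) * fn w x, \<lambda>x. 1 * lap v x + (- 1) * lap w x,
    \<lambda>x. 1 * tr v x + (- 1) * tr w x)"
    by (simp add: prod_eq_iff fn_def lap_def tr_def fun_diff_def)
  then show ?thesis using Hspace_lincomb[OF assms, of 1 "- 1"] by simp
qed

text \<open>For each \<open>\<phi> n\<close> the witnesses in \<open>apriori_constant\<close> are
  its classical Laplacian and \<open>\<phi> n\<close> itself as trace; all three norms converge
  along the sequence.\<close>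

lemma apriori_Hspace:
  assumes C: "apriori_constant \<Omega> C\<^sub>1" and \<Omega>: "open \<Omega>" "bounded \<Omega>" and v: "v \<in> Hspace \<Omega>"
  shows "C\<^sub>1 * (norm_H_half \<Omega> (fn v))\<^sup>2 \<le> (norm_dom \<Omega> (lap v))\<^sup>2 + (norm_bdry \<Omega> (tr v))\<^sup>2"
proof -
  obtain \<phi> where \<phi>: "\<And>n. \<phi> n \<in> smooth" "H_half_conv \<Omega> \<phi> (fn v)"
      "L2_conv (lebesgue_on \<Omega>) (\<lambda>n. laplace (\<phi> n)) (lap v)" "L2_conv (surface_measure \<Omega>) \<phi> (tr v)"
    using v by (auto simp: Hspace_def)
  have "C\<^sub>1 * (norm_H_half \<Omega> (\<phi> n))\<^sup>2 \<le> (norm_dom \<Omega> (laplace (\<phi> n)))\<^sup>2 + (norm_bdry \<Omega> (\<phi> n))\<^sup>2" for n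
    using C smooth_sobolev[OF \<Omega> \<phi>(1)] smooth_weak_laplace[OF \<phi>(1) \<Omega>]
      smooth_is_trace[OF \<phi>(1) L2_convD(1)[OF \<phi>(4)] \<Omega>]
    by (auto simp: apriori_constant_def)
  then show ?thesis
    by (intro LIMSEQ_le[OF tendsto_mult_left[OF tendsto_power[OF norm_H_half_conv[OF \<phi>(2)]]]
          tendsto_add[OF tendsto_power[OF L2_conv_norm[OF \<phi>(3)]] tendsto_power[OF L2_conv_norm[OF \<phi>(4)]]]])
       auto
qed

section \<open>The energy\<close>

text \<open>This is \<open>energy\<close> with the data \<open>u\<^sub>d\<close> and
  \<open>g\<close> both replaced by zero.\<close>

definition energy_quad ::
  "'a::euclidean_space set \<Rightarrow> real \<Rightarrow> 'a helem \<Rightarrow> ('a \<Rightarrow> real) \<Rightarrow> real"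
where
  "energy_quad \<Omega> \<eta> z k =
     1/2 * (norm_dom \<Omega> (\<lambda>x. lap z x + k x))\<^sup>2 + 1/2 * (norm_dom \<Omega> (fn z))\<^sup>2 +
     1/2 * (norm_bdry \<Omega> (tr z))\<^sup>2 + \<eta>\<^sup>2 / 2 * (norm_dom \<Omega> k)\<^sup>2"

text \<open>For small \<open>t\<close> of sign opposite to \<open>B\<close> the linear term
  outweighs the quadratic one, whatever the sign of \<open>Q\<close>.\<close>

lemma linear_coeff_eq_0:
  fixes B Q :: real
  assumes "\<And>t. 0 \<le> t * B + t\<^sup>2 * Q"
  shows "B = 0"
proof (rule ccontr)
  assume B: "B \<noteq> 0"
  \<comment> \<open>The choice ensures \<open>s * Q < 1\<close>; the added 1 keeps the denominator
    positive when \<open>Q = 0\<close>.\<close>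
  define s where "s = 1 / (\<bar>Q\<bar> + 1)"
  have s: "s > 0" "s * Q < 1" by (auto simp: s_def field_simps)
  have "0 \<le> (- s * B) * B + (- s * B)\<^sup>2 * Q" by (rule assms)
  also have "\<dots> = s * B\<^sup>2 * (s * Q - 1)" by (simp add: power2_eq_square algebra_simps)
  also have "\<dots> < 0" using s B by (intro mult_pos_neg) auto
  finally show False by simp
qed

lemma energy_eq_min_plus_quad:
  assumes uf: "exact_solution \<Omega> u\<^sub>d g \<eta> u f" and g: "u\<^sub>d \<in> L2_dom \<Omega>" "g \<in> L2_bdry \<Omega>"
    and v: "v \<in> Hspace \<Omega>" "h \<in> L2_dom \<Omega>"
  shows "energy \<Omega> u\<^sub>d g \<eta> v h = energy \<Omega> u\<^sub>d g \<eta> u f + energy_quad \<Omega> \<eta> (v - u) (h - f)"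
proof -
  let ?D = "lebesgue_on \<Omega>" and ?S = "surface_measure \<Omega>"
  have u: "u \<in> Hspace \<Omega>" "f \<in> L2_dom \<Omega>" using uf by (auto simp: exact_solution_def)
  define z where "z = v - u"
  define k where "k = h - f"
  have z: "z \<in> Hspace \<Omega>" using v u by (auto simp: z_def intro: Hspace_diff)
  have k: "k \<in> L2_dom \<Omega>" using v u by (auto simp: k_def fun_diff_def intro: L2_diff)
  \<comment> \<open>The line through the minimizer in direction \<open>z\<close>, in the form of
    \<open>Hspace_lincomb\<close>; along it the energy is a quadratic polynomial in
    \<open>t\<close>.\<close>
  define w where "w t = (\<lambda>x. 1 * fn u x + t * fn z x, \<lambda>x. 1 * lap u x + t * lap z x,
    \<lambda>x. 1 * tr u x + t * tr z x)" for t
  have w: "w t \<in> Hspace \<Omega>" for t unfolding w_def by (rule Hspace_lincomb[OF u(1) z])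
  have fk: "(\<lambda>x. f x + t * k x) \<in> L2_dom \<Omega>" for t
    using L2_lincomb[OF u(2) k, of 1 t] by simp
  \<comment> \<open>The directional derivative of the energy at \<open>(u, f)\<close> in direction
    \<open>(z, k)\<close>.\<close>
  define B where "B =
    (LINT x|?D. (lap u x + f x) * (lap z x + k x)) + (LINT x|?D. (fn u x - u\<^sub>d x) * fn z x) +
    (LINT x|?S. (tr u x - g x) * tr z x) + \<eta>\<^sup>2 * (LINT x|?D. f x * k x)"
  have E: "energy \<Omega> u\<^sub>d g \<eta> (w t) (\<lambda>x. f x + t * k x) =
      energy \<Omega> u\<^sub>d g \<eta> u f + t * B + t\<^sup>2 * energy_quad \<Omega> \<eta> z k" for t
  proof -
    note D = HspaceD[OF u(1)] HspaceD[OF z]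
    have 1: "(\<lambda>x. lap (w t) x + (f x + t * k x)) = (\<lambda>x. (lap u x + f x) + t * (lap z x + k x))"
      and 2: "(\<lambda>x. fn (w t) x - u\<^sub>d x) = (\<lambda>x. (fn u x - u\<^sub>d x) + t * fn z x)"
      and 3: "(\<lambda>x. tr (w t) x - g x) = (\<lambda>x. (tr u x - g x) + t * tr z x)"
      by (auto simp: w_def fn_def lap_def tr_def algebra_simps)
    show ?thesis
      unfolding energy_def energy_quad_def B_def 1 2 3
        L2norm_power2_add_scaled[OF L2_add[OF D(2) u(2)] L2_add[OF D(5) k]]
        L2norm_power2_add_scaled[OF L2_diff[OF D(1) g(1)] D(4)]
        L2norm_power2_add_scaled[OF L2_diff[OF D(3) g(2)] D(6)]
        L2norm_power2_add_scaled[OF u(2) k]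
      by (simp add: field_simps)
  qed
  have "0 \<le> t * B + t\<^sup>2 * energy_quad \<Omega> \<eta> z k" for t
    using uf w[of t] fk[of t] E[of t] unfolding exact_solution_def by (smt (verit))
  then have B: "B = 0" by (rule linear_coeff_eq_0)
  \<comment> \<open>With \<open>B = 0\<close>, the expansion at \<open>t = 1\<close> is the
    claim.\<close>
  have "w 1 = v" "(\<lambda>x. f x + 1 * k x) = h"
    by (auto simp: w_def z_def k_def helem_diff_simps) (simp_all add: fn_def lap_def tr_def)
  with E[of 1] B show ?thesis by (simp add: z_def k_def)
qed

section \<open>Coercivity and boundedness of the quadratic part\<close>

lemma weighted_square_ge:
  fixes a b \<beta> :: real
  assumes "0 < \<beta>" "\<beta> < 1"
  shows "\<beta> * a\<^sup>2 \<le> (a + b)\<^sup>2 + \<beta> / (1 - \<beta>) * b\<^sup>2"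
proof -
  \<comment> \<open>The weight \<open>\<beta> / (1 - \<beta>)\<close> is the one for which the
    difference becomes a perfect square.\<close>
  have "(a + b)\<^sup>2 + \<beta> / (1 - \<beta>) * b\<^sup>2 - \<beta> * a\<^sup>2 = ((1 - \<beta>) * a + b)\<^sup>2 / (1 - \<beta>)"
    using assms by (simp add: field_simps power2_eq_square)
  also have "\<dots> \<ge> 0" using assms by simp
  finally show ?thesis by simp
qed

lemma L2norm_weighted_ge:
  assumes \<beta>: "0 < \<beta>" "\<beta> < 1" and a: "a \<in> L2 M" "b \<in> L2 M"
  shows "\<beta> * (L2norm M a)\<^sup>2 \<le> (L2norm M (\<lambda>x. a x + b x))\<^sup>2 + \<beta> / (1 - \<beta>) * (L2norm M b)\<^sup>2"
proof -
  note i = L2D(2)[OF a(1)] L2D(2)[OF a(2)] L2D(2)[OF L2_add[OF a]]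
  have "(LINT x|M. \<beta> * (a x)\<^sup>2) \<le> (LINT x|M. (a x + b x)\<^sup>2 + \<beta> / (1 - \<beta>) * (b x)\<^sup>2)"
    by (intro integral_mono Bochner_Integration.integrable_add integrable_mult_right i
          weighted_square_ge \<beta>)
  also have "\<dots> = (LINT x|M. (a x + b x)\<^sup>2) + (LINT x|M. \<beta> / (1 - \<beta>) * (b x)\<^sup>2)"
    by (intro Bochner_Integration.integral_add integrable_mult_right i)
  finally show ?thesis unfolding L2norm_power2 by simp
qed

text \<open>A share \<beta> of the boundary term joins
  \<open>\<beta> * (norm_dom \<Omega> (lap z))\<^sup>2\<close> in the a priori estimate, leaving the
  factor \<open>1 - \<beta>\<close>. Recovering the Laplacian from the residual
  \<open>lap z + k\<close> costs \<open>\<beta> / (1 - \<beta>)\<close>, which is taken out of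
  \<open>\<eta>\<^sup>2\<close>.\<close>

lemma energy_quad_ge:
  assumes \<beta>: "0 < \<beta>" "\<beta> < 1" and C: "apriori_constant \<Omega> C\<^sub>1" and \<Omega>: "open \<Omega>" "bounded \<Omega>"
    and z: "z \<in> Hspace \<Omega>" "k \<in> L2_dom \<Omega>"
  shows "C\<^sub>1 * \<beta> * (norm_H_half \<Omega> (fn z))\<^sup>2 + (1 - \<beta>) * (norm_bdry \<Omega> (tr z))\<^sup>2 +
    (\<eta>\<^sup>2 - \<beta> / (1 - \<beta>)) * (norm_dom \<Omega> k)\<^sup>2 \<le> 2 * energy_quad \<Omega> \<eta> z k"
proof -
  have "\<beta> * (C\<^sub>1 * (norm_H_half \<Omega> (fn z))\<^sup>2) \<le> \<beta> * ((norm_dom \<Omega> (lap z))\<^sup>2 + (norm_bdry \<Omega> (tr z))\<^sup>2)"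
    using apriori_Hspace[OF C \<Omega> z(1)] \<beta> by (intro mult_left_mono) auto
  moreover have "0 \<le> (norm_dom \<Omega> (fn z))\<^sup>2" by simp
  moreover note L2norm_weighted_ge[OF \<beta> HspaceD(2)[OF z(1)] z(2)]
  moreover have "C\<^sub>1 * \<beta> * (norm_H_half \<Omega> (fn z))\<^sup>2 = \<beta> * (C\<^sub>1 * (norm_H_half \<Omega> (fn z))\<^sup>2)"
    and "\<eta>\<^sup>2 / 2 * (norm_dom \<Omega> k)\<^sup>2 = (\<eta>\<^sup>2 * (norm_dom \<Omega> k)\<^sup>2) / 2"
    by simp_all
  ultimately show ?thesis
    unfolding energy_quad_def ring_distribs by linarith
qed

lemma energy_quad_le:
  assumes C: "apriori_constant \<Omega> C\<^sub>1" and \<Omega>: "open \<Omega>" "bounded \<Omega>"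
    and z: "z \<in> Hspace \<Omega>" "k \<in> L2_dom \<Omega>"
  shows "energy_quad \<Omega> \<eta> z k \<le> (2 + 1 / C\<^sub>1 + \<eta>\<^sup>2) * ((norm_H \<Omega> z)\<^sup>2 + (norm_dom \<Omega> k)\<^sup>2)"
proof -
  define a b c d where "a = norm_dom \<Omega> (lap z)" "b = norm_bdry \<Omega> (tr z)"
    "c = norm_dom \<Omega> (fn z)" "d = norm_dom \<Omega> k"
  have nn: "0 \<le> a" "0 \<le> b" by (auto simp: a_b_c_d_def)
  have C1: "C\<^sub>1 > 0" using C by (simp add: apriori_constant_def)
  define m where "m = 1 / C\<^sub>1"
  have m: "m \<ge> 0" using C1 by (simp add: m_def)
  have "norm_dom \<Omega> (\<lambda>x. lap z x + k x) \<le> a + d"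
    unfolding a_b_c_d_def by (rule L2norm_add_le[OF HspaceD(2)[OF z(1)] z(2)])
  then have "(norm_dom \<Omega> (\<lambda>x. lap z x + k x))\<^sup>2 \<le> (a + d)\<^sup>2" by (rule power_mono) simp
  also have "\<dots> \<le> 2 * a\<^sup>2 + 2 * d\<^sup>2" using sum_squares_bound[of a d] by (simp add: power2_sum)
  finally have 1: "(norm_dom \<Omega> (\<lambda>x. lap z x + k x))\<^sup>2 \<le> 2 * a\<^sup>2 + 2 * d\<^sup>2" .
  \<comment> \<open>The norm \<open>norm_H\<close> does not contain \<open>c\<close>; the a priori
    estimate controls it, which brings \<open>1 / C\<^sub>1\<close> into the constant.\<close>
  have "C\<^sub>1 * c\<^sup>2 \<le> C\<^sub>1 * (norm_H_half \<Omega> (fn z))\<^sup>2"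
    using C1 by (simp add: norm_H_half_power2 a_b_c_d_def)
  also have "\<dots> \<le> a\<^sup>2 + b\<^sup>2"
    using apriori_Hspace[OF C \<Omega> z(1)] by (simp add: a_b_c_d_def)
  finally have 2: "c\<^sup>2 \<le> m * (a\<^sup>2 + b\<^sup>2)" using C1 by (simp add: m_def field_simps)
  have ab: "a\<^sup>2 + b\<^sup>2 \<le> (a + b)\<^sup>2" using nn by (simp add: power2_sum)
  have "energy_quad \<Omega> \<eta> z k \<le> a\<^sup>2 + d\<^sup>2 + 1/2 * c\<^sup>2 + 1/2 * b\<^sup>2 + \<eta>\<^sup>2 / 2 * d\<^sup>2"
    unfolding energy_quad_def using 1 by (simp add: a_b_c_d_def)
  also have "\<dots> \<le> 2 * (a\<^sup>2 + b\<^sup>2) + 2 * d\<^sup>2 + m * (a\<^sup>2 + b\<^sup>2) + \<eta>\<^sup>2 * d\<^sup>2"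
  proof -
    have "0 \<le> a\<^sup>2" "0 \<le> b\<^sup>2" "0 \<le> c\<^sup>2" "0 \<le> d\<^sup>2" "0 \<le> \<eta>\<^sup>2 * d\<^sup>2" by simp_all
    moreover have "\<eta>\<^sup>2 / 2 * d\<^sup>2 = (\<eta>\<^sup>2 * d\<^sup>2) / 2" by simp
    ultimately show ?thesis using 2 by argo
  qed
  \<comment> \<open>The added nonnegative terms make the sum factor as one constant times one sum of
    squares.\<close>
  also have "\<dots> \<le> 2 * (a\<^sup>2 + b\<^sup>2) + 2 * d\<^sup>2 + m * (a\<^sup>2 + b\<^sup>2) + \<eta>\<^sup>2 * d\<^sup>2
      + \<eta>\<^sup>2 * (a\<^sup>2 + b\<^sup>2) + m * d\<^sup>2"
    using m by simp
  also have "\<dots> = (2 + m + \<eta>\<^sup>2) * ((a\<^sup>2 + b\<^sup>2) + d\<^sup>2)"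
    by (simp add: distrib_left distrib_right)
  also have "\<dots> \<le> (2 + m + \<eta>\<^sup>2) * ((a + b)\<^sup>2 + d\<^sup>2)"
    using ab m by (intro mult_left_mono add_right_mono add_nonneg_nonneg) auto
  finally show ?thesis by (simp add: norm_H_def a_b_c_d_def m_def)
qed

section \<open>The two error estimates\<close>

lemma energy_nonneg: "0 \<le> energy \<Omega> u\<^sub>d g \<eta> v h"
  by (simp add: energy_def)

theorem theorem11:
  fixes \<Omega> :: "'a::euclidean_space set"
    and u\<^sub>d g f :: "'a \<Rightarrow> real" and u :: "'a helem"
    and \<beta> \<eta> C\<^sub>1 C\<^sub>3 :: real
    and \<Theta>\<^sub>1 :: "'p set" and \<Theta>\<^sub>2 :: "'q set"
    and U :: "'p \<Rightarrow> 'a helem" and F :: "'q \<Rightarrow> 'a \<Rightarrow> real"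
    and L :: "'p \<times> 'q \<Rightarrow> real"
  assumes "bounded_C11_domain \<Omega>"
    and "u\<^sub>d \<in> L2_dom \<Omega>" and "g \<in> L2_bdry \<Omega>"
    and "0 < \<beta>" and "\<beta> < 1" and "\<eta> > 0" and "\<eta>\<^sup>2 > \<beta> / (1 - \<beta>)"
    and "C\<^sub>3 = \<eta>\<^sup>2 - \<beta> / (1 - \<beta>)"
    and "apriori_constant \<Omega> C\<^sub>1"
    and "exact_solution \<Omega> u\<^sub>d g \<eta> u f"
    and "U ` \<Theta>\<^sub>1 \<subseteq> Hspace \<Omega>" and "F ` \<Theta>\<^sub>2 \<subseteq> L2_dom \<Omega>"
  shows "\<exists>C>0. \<forall>\<theta>\<^sub>1\<in>\<Theta>\<^sub>1. \<forall>\<theta>\<^sub>2\<in>\<Theta>\<^sub>2.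
    (let E = energy \<Omega> u\<^sub>d g \<eta>;
         err = C\<^sub>1 * \<beta> * (norm_H_half \<Omega> (fn (U \<theta>\<^sub>1 - u)))\<^sup>2
               + (1 - \<beta>) * (norm_bdry \<Omega> (tr (U \<theta>\<^sub>1 - u)))\<^sup>2
               + C\<^sub>3 * (norm_dom \<Omega> (F \<theta>\<^sub>2 - f))\<^sup>2;
         \<eta>_quad = E (U \<theta>\<^sub>1) (F \<theta>\<^sub>2) - L (\<theta>\<^sub>1, \<theta>\<^sub>2);
         \<delta> = E (U \<theta>\<^sub>1) (F \<theta>\<^sub>2) - (INF (v, h) \<in> U ` \<Theta>\<^sub>1 \<times> F ` \<Theta>\<^sub>2. E v h)
     in err \<le> C * (L (\<theta>\<^sub>1, \<theta>\<^sub>2) + \<eta>_quad) \<and>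
        err \<le> C * (\<delta> + (INF (v, h) \<in> U ` \<Theta>\<^sub>1 \<times> F ` \<Theta>\<^sub>2.
                          (norm_H \<Omega> (v - u))\<^sup>2 + (norm_dom \<Omega> (h - f))\<^sup>2)))"
proof -
  have \<Omega>: "open \<Omega>" "bounded \<Omega>" using assms(1) by (auto simp: bounded_C11_domain_def)
  have u: "u \<in> Hspace \<Omega>" "f \<in> L2_dom \<Omega>" using assms(10) by (auto simp: exact_solution_def)
  have C1: "C\<^sub>1 > 0" using assms(9) by (simp add: apriori_constant_def)
  define E where "E = energy \<Omega> u\<^sub>d g \<eta>"
  define P where "P = U ` \<Theta>\<^sub>1 \<times> F ` \<Theta>\<^sub>2"
  \<comment> \<open>The constant of \<open>energy_quad_le\<close>. It depends only on
    \<open>C\<^sub>1\<close> and \<eta>, so the final constant \<open>2 * K\<close> is independent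
    of the parameters.\<close>
  define K where "K = 2 + 1 / C\<^sub>1 + \<eta>\<^sup>2"
  define dist2 where "dist2 v h = (norm_H \<Omega> (v - u))\<^sup>2 + (norm_dom \<Omega> (h - f))\<^sup>2" for v h
  have K: "K \<ge> 1" using C1 by (simp add: K_def)
  have in_space: "v \<in> Hspace \<Omega>" "h \<in> L2_dom \<Omega>" "v - u \<in> Hspace \<Omega>" "h - f \<in> L2_dom \<Omega>"
    if "(v, h) \<in> P" for v h
    using that assms(11,12) u by (auto simp: P_def fun_diff_def intro: Hspace_diff L2_diff)
  have upper: "E v h \<le> E u f + K * dist2 v h" if "(v, h) \<in> P" for v h
    using energy_eq_min_plus_quad[OF assms(10,2,3) in_space(1,2)[OF that]]
      energy_quad_le[OF assms(9) \<Omega> in_space(3,4)[OF that], of \<eta>]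
    by (simp add: E_def K_def dist2_def)
  \<comment> \<open>Boundedness below makes the real-valued infimum of the energy a genuine lower
    bound.\<close>
  have bdd: "bdd_below ((\<lambda>(v, h). E v h) ` P)"
    by (rule bdd_belowI2[of _ 0]) (auto simp: E_def energy_nonneg)
  have bound: "err \<le> (2 * K) * E v h \<and> err \<le> (2 * K) * (E v h - (INF (v, h) \<in> P. E v h) +
        (INF (v, h) \<in> P. dist2 v h))"
    if vh: "(v, h) \<in> P" and err: "err = C\<^sub>1 * \<beta> * (norm_H_half \<Omega> (fn (v - u)))\<^sup>2
               + (1 - \<beta>) * (norm_bdry \<Omega> (tr (v - u)))\<^sup>2 + C\<^sub>3 * (norm_dom \<Omega> (h - f))\<^sup>2" for v h err
  proof
    have err_le: "err \<le> 2 * (E v h - E u f)"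
      using energy_eq_min_plus_quad[OF assms(10,2,3) in_space(1,2)[OF vh]]
        energy_quad_ge[OF assms(4,5,9) \<Omega> in_space(3,4)[OF vh], of \<eta>]
      by (simp add: E_def err assms(8))
    have E0: "0 \<le> E u f" "0 \<le> E v h" by (auto simp: E_def energy_nonneg)
    \<comment> \<open>Here 2 alone suffices, since \<open>E u f\<close> is nonnegative;
      \<open>K \<ge> 1\<close> enlarges it to the common constant.\<close>
    show "err \<le> (2 * K) * E v h"
      using err_le E0 mult_right_mono[OF K E0(2)] by simp
    let ?I = "INF (v, h) \<in> P. E v h"
    have I: "?I \<le> E v h" using cINF_lower[OF bdd vh] by simp
    \<comment> \<open>Dividing by \<open>K\<close> turns \<open>upper\<close> into a lower bound for
      \<open>dist2\<close> that holds throughout \<open>P\<close>, hence one for its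
      infimum.\<close>
    have "(?I - E u f) / K \<le> (INF (v, h) \<in> P. dist2 v h)"
    proof (rule cINF_greatest)
      show "P \<noteq> {}" using vh by auto
      fix p assume p: "p \<in> P"
      obtain v' h' where [simp]: "p = (v', h')" by (cases p)
      have "?I \<le> E v' h'" using cINF_lower[OF bdd p] by simp
      also have "\<dots> \<le> E u f + K * dist2 v' h'" using upper p by simp
      finally show "(?I - E u f) / K \<le> (case p of (v, h) \<Rightarrow> dist2 v h)"
        using K by (simp add: field_simps)
    qed
    then have "?I - E u f \<le> K * (INF (v, h) \<in> P. dist2 v h)"
      using K by (simp add: field_simps)
    \<comment> \<open>The optimization gap is nonnegative, so it too may be multiplied by
      \<open>K\<close>. Adding both bounds \<open>E v h - E u f\<close>.\<close>
    moreover have "E v h - ?I \<le> K * (E v h - ?I)"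
      using mult_right_mono[OF K, of "E v h - ?I"] I by simp
    ultimately show "err \<le> (2 * K) * (E v h - ?I + (INF (v, h) \<in> P. dist2 v h))"
      using err_le by (simp add: algebra_simps)
  qed
  show ?thesis
  proof (intro exI[of _ "2 * K"] conjI ballI)
    show "0 < 2 * K" using K by simp
    fix \<theta>\<^sub>1 \<theta>\<^sub>2 assume "\<theta>\<^sub>1 \<in> \<Theta>\<^sub>1" "\<theta>\<^sub>2 \<in> \<Theta>\<^sub>2"
    then have "(U \<theta>\<^sub>1, F \<theta>\<^sub>2) \<in> P" by (auto simp: P_def)
    \<comment> \<open>In the first estimate the loss cancels:
      \<open>L (\<theta>\<^sub>1, \<theta>\<^sub>2) + \<eta>_quad\<close> is the energy itself, so
      no property of \<open>L\<close> enters.\<close>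
    from bound[OF this refl]
    show "let E = energy \<Omega> u\<^sub>d g \<eta>;
         err = C\<^sub>1 * \<beta> * (norm_H_half \<Omega> (fn (U \<theta>\<^sub>1 - u)))\<^sup>2
               + (1 - \<beta>) * (norm_bdry \<Omega> (tr (U \<theta>\<^sub>1 - u)))\<^sup>2
               + C\<^sub>3 * (norm_dom \<Omega> (F \<theta>\<^sub>2 - f))\<^sup>2;
         \<eta>_quad = E (U \<theta>\<^sub>1) (F \<theta>\<^sub>2) - L (\<theta>\<^sub>1, \<theta>\<^sub>2);
         \<delta> = E (U \<theta>\<^sub>1) (F \<theta>\<^sub>2) - (INF (v, h) \<in> U ` \<Theta>\<^sub>1 \<times> F ` \<Theta>\<^sub>2. E v h)
     in err \<le> 2 * K * (L (\<theta>\<^sub>1, \<theta>\<^sub>2) + \<eta>_quad) \<and>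
        err \<le> 2 * K * (\<delta> + (INF (v, h) \<in> U ` \<Theta>\<^sub>1 \<times> F ` \<Theta>\<^sub>2.
                          (norm_H \<Omega> (v - u))\<^sup>2 + (norm_dom \<Omega> (h - f))\<^sup>2))"
      unfolding Let_def E_def [symmetric] P_def [symmetric] dist2_def [symmetric] by simp
  qed
qed

end
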